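(* Let $A,B \in \mathbb{C}^{n \times n}$, where the group inverse $B^{\#}$ exists, be such that $$AB^{\#}+BB^{\#}=0 \quad \text{and} \quad B^{\#}A+B^{\#}B=0.$$ Then $$(A+B)^{\#}=A^{\#}+B^{\#}.$$
   Context: $\mathbb{C}^{n\times n}$ is the set of complex $n\times n$ matrices. For $A\in\mathbb{C}^{n\times n}$, if there exists $X\in\mathbb{C}^{n\times n}$ with $AXA=A$, $XAX=X$ and $AX=XA$, then $X$ is unique, is called the group inverse of $A$, and is denoted $A^{\#}$. The group inverse of a given matrix need not exist; it exists if and only if $\mathrm{rank}(A^2)=\mathrm{rank}(A)$.
   Formalization: The existence of A^# does not follow from the hypotheses (B = 0, A nonzero nilpotent), so the equation is asserted when A^# exists, together with the claim that (A+B)^# exists if and only if A^# does. *)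

theory Defs
  imports "HOL-Analysis.Analysis"
begin

definition is_group_inverse :: "complex^'n^'n \<Rightarrow> complex^'n^'n \<Rightarrow> bool" where
  "is_group_inverse A X \<longleftrightarrow> A ** X ** A = A \<and> X ** A ** X = X \<and> A ** X = X ** A"

definition group_invertible :: "complex^'n^'n \<Rightarrow> bool" where
  "group_invertible A \<longleftrightarrow> (\<exists>X. is_group_inverse A X)"

lemma is_group_inverse_unique:
  assumes "is_group_inverse A X" "is_group_inverse A Y"
  shows "X = Y"
proof -
  have x: "A ** X ** A = A" "X ** A ** X = X" "A ** X = X ** A"
    and y: "A ** Y ** A = A" "Y ** A ** Y = Y" "A ** Y = Y ** A"
    using assms by (auto simp: is_group_inverse_def)
  have "X ** A = X ** (A ** Y ** A)" by (simp add: y(1))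
  also have "\<dots> = X ** A ** (Y ** A)" by (simp add: matrix_mul_assoc)
  also have "\<dots> = A ** X ** (A ** Y)" by (simp add: x(3) y(3))
  also have "\<dots> = A ** X ** A ** Y" by (simp add: matrix_mul_assoc)
  also have "\<dots> = A ** Y" by (simp only: x(1))
  finally have e: "X ** A = A ** Y" .
  have "X = X ** A ** X" by (simp add: x(2))
  also have "\<dots> = X ** (A ** X)" by (simp add: matrix_mul_assoc)
  also have "\<dots> = X ** (A ** Y)" by (simp add: x(3) e)
  also have "\<dots> = A ** Y ** Y" by (simp add: matrix_mul_assoc e)
  also have "\<dots> = Y ** A ** Y" by (simp add: y(3))
  finally show ?thesis by (simp add: y(2))
qed

text \<open>Only meaningful for group invertible matrices; an arbitrary value otherwise.\<close>

definition group_inverse :: "complex^'n^'n \<Rightarrow> complex^'n^'n" where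
  "group_inverse A = (THE X. is_group_inverse A X)"

lemma is_group_inverse_group_inverse:
  "group_invertible A \<Longrightarrow> is_group_inverse A (group_inverse A)"
  unfolding group_inverse_def group_invertible_def
  by (metis is_group_inverse_unique theI')

end

theory Submission
  imports Defs
begin

text \<open>
  Write \<open>Y\<close> for the group inverse of \<open>B\<close> and \<open>P = BY = YB\<close> for the associated idempotent. The
  hypotheses read \<open>AY = YA = - P\<close>, and multiplying by \<open>B\<close> gives \<open>AP = PA = - B\<close>: with respect to
  the splitting of the space into the range and the kernel of \<open>P\<close>, the matrix \<open>A\<close> is block
  diagonal and its block on the range of \<open>P\<close> is that of \<open>- B\<close>. Hence \<open>A + B\<close> is just the
  block of \<open>A\<close> on the kernel of \<open>P\<close>, that is, \<open>A = (A + B) + (- B)\<close> is a decomposition into two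
  summands that annihilate each other.

  Group inverses of mutually annihilating matrices add up (\<open>is_group_inverse_orthogonal_add\<close>), so a
  group inverse of \<open>A + B\<close> yields one of \<open>A\<close>. Conversely a group inverse of \<open>A\<close> has the block
  \<open>- Y\<close> on the range of \<open>P\<close>, and adding \<open>Y\<close> deletes this block and leaves the group inverse of
  \<open>A + B\<close> (\<open>is_group_inverse_add_of_cancelling\<close>).
\<close>

lemma matrix_mul_lminus: "(- A) ** B = - (A ** B)"
  for A :: "complex^'n^'m" and B :: "complex^'k^'n"
  by (simp add: matrix_matrix_mult_def vec_eq_iff sum_negf)

lemma matrix_mul_rminus: "A ** (- B) = - (A ** B)"
  for A :: "complex^'n^'m" and B :: "complex^'k^'n"
  by (simp add: matrix_matrix_mult_def vec_eq_iff sum_negf)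

lemma matrix_add_rdistrib: "(A + B) ** C = A ** C + B ** C"
  for A B :: "complex^'n^'m" and C :: "complex^'k^'n"
  by (simp add: matrix_matrix_mult_def vec_eq_iff distrib_right sum.distrib)

lemma matrix_sub_rdistrib: "(A - B) ** C = A ** C - B ** C"
  for A B :: "complex^'n^'m" and C :: "complex^'k^'n"
  by (simp add: matrix_matrix_mult_def vec_eq_iff left_diff_distrib sum_subtractf)

lemmas matrix_ring_simps =
  matrix_add_ldistrib matrix_add_rdistrib matrix_mul_lminus matrix_mul_rminus

lemma is_group_inverse_uminus:
  "is_group_inverse A X \<Longrightarrow> is_group_inverse (- A) (- X)"
  unfolding is_group_inverse_def by (metis matrix_mul_lminus matrix_mul_rminus minus_minus)

lemma is_group_inverse_sym: "is_group_inverse A X \<Longrightarrow> is_group_inverse X A"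
  unfolding is_group_inverse_def by metis

text \<open>
  The group inverse satisfies \<open>X = XXA = AXX\<close>, so whatever \<open>A\<close> annihilates on either side is
  annihilated by \<open>X\<close> as well.
\<close>

lemma group_inverse_annihilates:
  assumes "is_group_inverse A X"
  shows "A ** C = 0 \<Longrightarrow> X ** C = 0" and "C ** A = 0 \<Longrightarrow> C ** X = 0"
proof -
  have "X = X ** X ** A" and "X = A ** X ** X"
    using assms by (metis is_group_inverse_def matrix_mul_assoc)+
  then show "A ** C = 0 \<Longrightarrow> X ** C = 0" and "C ** A = 0 \<Longrightarrow> C ** X = 0"
    by (metis matrix_mul_assoc times0_right, metis matrix_mul_assoc times0_left)
qed

text \<open>
  All mixed products vanish, because annihilation passes from each matrix to its group inverse; each
  defining equation for the sum is therefore the sum of the two given ones.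
\<close>

lemma is_group_inverse_orthogonal_add:
  assumes X: "is_group_inverse S X" and Y: "is_group_inverse D Y"
    and SD: "S ** D = 0" and DS: "D ** S = 0"
  shows "is_group_inverse (S + D) (X + Y)"
proof -
  have mixed: "X ** D = 0" "D ** X = 0" "S ** Y = 0" "Y ** S = 0"
    using group_inverse_annihilates[OF X] group_inverse_annihilates[OF Y] SD DS by auto
  have x: "S ** X ** S = S" "X ** S ** X = X" "S ** X = X ** S"
    and y: "D ** Y ** D = D" "Y ** D ** Y = Y" "D ** Y = Y ** D"
    using X Y by (auto simp: is_group_inverse_def)
  have left: "(S + D) ** (X + Y) = S ** X + D ** Y"
    and right: "(X + Y) ** (S + D) = X ** S + Y ** D"
    using mixed by (simp_all add: matrix_add_ldistrib matrix_add_rdistrib)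
  have "S ** X ** D = 0" "D ** Y ** S = 0" "X ** S ** Y = 0" "Y ** D ** X = 0"
    using mixed by (simp_all add: matrix_mul_assoc[symmetric])
  then have "(S ** X + D ** Y) ** (S + D) = S + D"
    and "(X ** S + Y ** D) ** (X + Y) = X + Y"
    by (simp_all only: x(1,2) y(1,2) matrix_add_ldistrib matrix_add_rdistrib
        add_0_left add_0_right)
  then show ?thesis
    unfolding is_group_inverse_def left right using x(3) y(3) by metis
qed

text \<open>
  \<open>B\<close> and \<open>Y\<close> have the same range and the same kernel, so a matrix such as \<open>A + B\<close> that annihilates
  \<open>Y\<close> on a side also annihilates \<open>B\<close> on that side.
\<close>

lemma sum_annihilates_of_cancelling:
  assumes Y: "is_group_inverse B Y"
    and AY: "A ** Y = - (B ** Y)" and YA: "Y ** A = - (Y ** B)"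
  shows "(A + B) ** B = 0" and "B ** (A + B) = 0"
proof -
  have "(A + B) ** Y = 0" and "Y ** (A + B) = 0"
    using AY YA by (simp_all add: matrix_ring_simps)
  \<comment> \<open>\<open>B\<close> is in turn the group inverse of \<open>Y\<close>, so it inherits what \<open>Y\<close> is annihilated by.\<close>
  moreover have "is_group_inverse Y B"
    using Y by (rule is_group_inverse_sym)
  ultimately show "(A + B) ** B = 0" and "B ** (A + B) = 0"
    using group_inverse_annihilates by blast+
qed

text \<open>
  Let \<open>P = BY\<close>. On the range of \<open>P\<close>, where \<open>A\<close> is \<open>- B\<close>, the group inverse \<open>X\<close> of \<open>A\<close> must be
  \<open>- Y\<close>, that is, \<open>XP = PX = - Y\<close>. Hence \<open>A + B\<close> and \<open>X + Y\<close> have the common product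
  \<open>AX - P\<close> in both orders, the idempotent of \<open>A\<close> with the part belonging to \<open>P\<close> removed.
\<close>

lemma is_group_inverse_add_of_cancelling:
  assumes X: "is_group_inverse A X" and Y: "is_group_inverse B Y"
    and AY: "A ** Y = - (B ** Y)" and YA: "Y ** A = - (Y ** B)"
  shows "is_group_inverse (A + B) (X + Y)"
proof -
  have x: "A ** X ** A = A" "X ** A ** X = X" "A ** X = X ** A"
    and y: "B ** Y ** B = B" "Y ** B ** Y = Y" "B ** Y = Y ** B"
    using X Y by (auto simp: is_group_inverse_def)
  define P where "P = B ** Y"
  note ann = sum_annihilates_of_cancelling[OF Y AY YA]
  have SP: "(A + B) ** P = 0" and PS: "P ** (A + B) = 0"
    using ann y(3) unfolding P_def
    by (metis matrix_mul_assoc times0_left, metis matrix_mul_assoc times0_right)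
  have AP: "A ** P = - B" and PA: "P ** A = - B"
    using SP PS y unfolding P_def
    by (simp_all add: matrix_ring_simps matrix_mul_assoc eq_neg_iff_add_eq_0)
  have AYP: "A ** Y = - P" and YAP: "Y ** A = - P"
    using AY YA y(3) by (simp_all add: P_def)
  have PY: "P ** Y = Y" and YP: "Y ** P = Y"
    using y unfolding P_def by (metis, metis matrix_mul_assoc)
  \<comment> \<open>\<open>Y = - AYY = - YYA\<close> has its columns and rows in the column and row space of \<open>A\<close>,
       where \<open>AX = XA\<close> is the identity.\<close>
  have Y_left: "Y = - (A ** Y ** Y)" and Y_right: "Y = - (Y ** (Y ** A))"
    using AYP YAP PY YP by (simp_all add: matrix_mul_lminus matrix_mul_rminus)
  have XAY: "X ** A ** Y = Y"
    using Y_left x by (metis matrix_mul_assoc matrix_mul_rminus)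
  have YAX: "Y ** A ** X = Y"
    using Y_right x by (metis matrix_mul_assoc matrix_mul_lminus)
  have XP: "X ** P = - Y" and PX: "P ** X = - Y"
    using XAY YAX AYP YAP
    by (metis matrix_mul_assoc matrix_mul_rminus minus_minus,
        metis matrix_mul_lminus minus_minus)
  have BX: "B ** X = - P" and XB: "X ** B = - P"
    using AP PA PX XP AYP YAP x(3)
    by (metis matrix_mul_assoc matrix_mul_rminus matrix_mul_lminus minus_minus y P_def)+
  have SX: "(A + B) ** (X + Y) = A ** X - P"
    using BX AYP by (simp add: matrix_ring_simps P_def)
  have XS: "(X + Y) ** (A + B) = A ** X - P"
    using XB YAP x(3) y(3) by (simp add: matrix_ring_simps P_def)
  have "A ** X ** B = B"
    using AP x(1) x(3) by (metis matrix_mul_assoc matrix_mul_rminus minus_minus)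
  then have "(A ** X - P) ** (A + B) = A + B"
    using PS x(1) by (simp only: matrix_sub_rdistrib) (simp add: matrix_add_ldistrib)
  moreover have "(A ** X - P) ** (X + Y) = X + Y"
    using PX PY XAY x(2,3) by (simp add: matrix_sub_rdistrib matrix_add_ldistrib)
  ultimately show ?thesis
    using SX XS by (simp add: is_group_inverse_def)
qed

theorem theorem4p4:
  fixes A B :: "complex^'n^'n"
  assumes "group_invertible B"
    and "A ** group_inverse B + B ** group_inverse B = 0"
    and "group_inverse B ** A + group_inverse B ** B = 0"
  shows "(group_invertible (A + B) \<longleftrightarrow> group_invertible A) \<and>
    (group_invertible A \<longrightarrow> group_inverse (A + B) = group_inverse A + group_inverse B)"
proof -
  define Y where "Y = group_inverse B"
  have Y: "is_group_inverse B Y"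
    unfolding Y_def by (rule is_group_inverse_group_inverse[OF assms(1)])
  have AY: "A ** Y = - (B ** Y)" and YA: "Y ** A = - (Y ** B)"
    using assms(2,3) unfolding Y_def by (simp_all add: eq_neg_iff_add_eq_0)
  have sum_to_A: "group_invertible A" if "group_invertible (A + B)"
  proof -
    obtain Z where "is_group_inverse (A + B) Z"
      using \<open>group_invertible (A + B)\<close> unfolding group_invertible_def by blast
    then have "is_group_inverse (A + B + - B) (Z + - Y)"
      using sum_annihilates_of_cancelling[OF Y AY YA]
      by (intro is_group_inverse_orthogonal_add is_group_inverse_uminus[OF Y])
        (simp_all add: matrix_mul_lminus matrix_mul_rminus)
    then show ?thesis
      unfolding group_invertible_def by auto
  qed
  have A_to_sum: "is_group_inverse (A + B) (group_inverse A + Y)" if "group_invertible A"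
    using is_group_inverse_group_inverse[OF that] Y AY YA
    by (rule is_group_inverse_add_of_cancelling)
  have "group_inverse (A + B) = group_inverse A + Y" if "group_invertible A"
    using A_to_sum[OF that] is_group_inverse_unique is_group_inverse_group_inverse
    unfolding group_invertible_def by blast
  with sum_to_A A_to_sum show ?thesis
    unfolding Y_def group_invertible_def by blast
qed

end
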